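(* Let $\kappa=(\{\kappa_n\},\{r_n\})$ be a measure of concordance and suppose that $r_n\to r$ as $n\to\infty$. Let $s>0$ be a fixed integer and, for each $n\ge\max(s,2)$, let $S=S_n\subseteq\{1,\dots,n\}$ with $\mathrm{card}(S_n)=s$. Then, with $M$ denoting the $n$-copula $M(t_1,\dots,t_n)=\min(t_1,\dots,t_n)$, $$\kappa_n(\sigma_{S_n}^*(M))\to(-1)^s(1-r)^s\quad\text{as } n\to\infty.$$
   Context: Notation. $I=[0,1]$, $\overline{n}=\{1,\dots,n\}$, and $[0,x]=[0,x_1]\times\cdots\times[0,x_n]$ for $x\in I^n$. For $n\ge 1$ an $n$-copula is a function $C:I^n\to I$ for which there is a (necessarily unique) Borel probability measure $\mu_C$ on $I^n$ whose one-dimensional marginals are all Lebesgue measure on $I$ and which satisfies $\mu_C([0,x])=C(x)$. $\Pi(t_1,\dots,t_n)=t_1\cdots t_n$. Symmetries. A permutation of $I^n$ is a map $\tau(x_1,\dots,x_n)=(x_{\tau'(1)},\dots,x_{\tau'(n)})$, where $\tau'$ is a permutation of $\overline n$. The elementary reflection $\sigma_i$ of $I^n$ replaces $x_i$ by $1-x_i$ and fixes the other coordinates; for $S=\{i_1,\dots,i_k\}\subseteq\overline n$, $\sigma_S=\sigma_{i_1}\cdots\sigma_{i_k}$ (identity if $S=\emptyset$). $\mathcal{R}_n=\{\sigma_S:S\subseteq\overline n\}$ and $\sigma=\sigma_{\overline n}$. For a permutation or reflection $\xi$ of $I^n$ and an $n$-copula $C$, $\xi^*(C)$ is the $n$-copula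 $[\xi^*(C)](x)=\mu_C(\xi([0,x]))$. For $n$-copulas $A,B$, $A\prec_{\mathcal C}B$ means $A\le B$ and $\sigma^*(A)\le\sigma^*(B)$ pointwise. A measure of concordance $\kappa=(\{\kappa_n\},\{r_n\})$ consists of maps $\kappa_n$ from the set of $n$-copulas to $\mathbb R$ and real numbers $r_n$, $n\ge2$, such that for all $n\ge2$ and all $n$-copulas $A,B,C,C_m$: A1 $\kappa_n(M)=1$, $\kappa_n(\Pi)=0$; A2 if $A\prec_{\mathcal C}B$ then $\kappa_n(A)\le\kappa_n(B)$; A3 if $C_m\to C$ uniformly then $\kappa_n(C_m)\to\kappa_n(C)$ as $m\to\infty$; A4 $\kappa_n(\tau^*(C))=\kappa_n(C)$ for every permutation $\tau$ of $I^n$; A5 $\kappa_n(\sigma^*(C))=\kappa_n(C)$; A6 $\sum_{\rho\in\mathcal R_n}\kappa_n(\rho^*(C))=0$; A7 $r_n\kappa_n(C)=\kappa_{n+1}(E)+\kappa_{n+1}(\sigma_1^*(E))$ whenever $E$ is an $(n+1)$-copula with $C(x_1,\dots,x_n)=E(1,x_1,\dots,x_n)$. *)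

theory Defs
  imports "HOL-Probability.Probability"
begin

(* Points of [0,1]^n are extensional functions on {1..n}: x i = undefined for i outside {1..n}. *)

definition Icube :: "nat \<Rightarrow> (nat \<Rightarrow> real) set" where
  "Icube n = {1..n} \<rightarrow>\<^sub>E {0..1}"

definition lower_box :: "nat \<Rightarrow> (nat \<Rightarrow> real) \<Rightarrow> (nat \<Rightarrow> real) set" where
  "lower_box n x = (\<Pi>\<^sub>E i\<in>{1..n}. {0..x i})"

(* For finitely many factors the product sigma-algebra of the Borel sets of [0,1]
   is the Borel sigma-algebra of [0,1]^n. *)

definition represents_copula :: "nat \<Rightarrow> (nat \<Rightarrow> real) measure \<Rightarrow> ((nat \<Rightarrow> real) \<Rightarrow> real) \<Rightarrow> bool" where
  "represents_copula n \<mu> C \<longleftrightarrow>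
     prob_space \<mu> \<and>
     sets \<mu> = sets (\<Pi>\<^sub>M i\<in>{1..n}. restrict_space borel {0..1}) \<and>
     (\<forall>i\<in>{1..n}. distr \<mu> (restrict_space borel {0..1}) (\<lambda>x. x i) = restrict_space lborel {0..1}) \<and>
     (\<forall>x\<in>Icube n. measure \<mu> (lower_box n x) = C x)"

(* Copulas are extensional on Icube n, so that two copulas are equal as HOL functions
   iff they agree on [0,1]^n. *)

definition copula :: "nat \<Rightarrow> ((nat \<Rightarrow> real) \<Rightarrow> real) \<Rightarrow> bool" where
  "copula n C \<longleftrightarrow> 1 \<le> n \<and> C \<in> Icube n \<rightarrow>\<^sub>E {0..1} \<and> (\<exists>\<mu>. represents_copula n \<mu> C)"

definition copula_measure :: "nat \<Rightarrow> ((nat \<Rightarrow> real) \<Rightarrow> real) \<Rightarrow> (nat \<Rightarrow> real) measure" where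
  "copula_measure n C = (THE \<mu>. represents_copula n \<mu> C)"

definition copula_M :: "nat \<Rightarrow> (nat \<Rightarrow> real) \<Rightarrow> real" where
  "copula_M n = (\<lambda>t\<in>Icube n. Min (t ` {1..n}))"

definition copula_Pi :: "nat \<Rightarrow> (nat \<Rightarrow> real) \<Rightarrow> real" where
  "copula_Pi n = (\<lambda>t\<in>Icube n. \<Prod>i\<in>{1..n}. t i)"

(* If p permutes {1..n} and i \<in> {1..n}, then these two maps send Icube n to itself;
   in particular they preserve extensionality. *)

definition permutation_map :: "(nat \<Rightarrow> nat) \<Rightarrow> (nat \<Rightarrow> real) \<Rightarrow> (nat \<Rightarrow> real)" where
  "permutation_map p x = (\<lambda>i. x (p i))"

definition elementary_reflection :: "nat \<Rightarrow> (nat \<Rightarrow> real) \<Rightarrow> (nat \<Rightarrow> real)" where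
  "elementary_reflection i x = x(i := 1 - x i)"

(* Composition of the elementary reflections over a finite set; they commute, so the order
   is immaterial (see reflection_apply for the closed form). *)

definition reflection :: "nat set \<Rightarrow> (nat \<Rightarrow> real) \<Rightarrow> (nat \<Rightarrow> real)" where
  "reflection S x = Finite_Set.fold elementary_reflection x S"

definition reflections :: "nat \<Rightarrow> ((nat \<Rightarrow> real) \<Rightarrow> (nat \<Rightarrow> real)) set" where
  "reflections n = reflection ` Pow {1..n}"

definition pullback ::
  "nat \<Rightarrow> ((nat \<Rightarrow> real) \<Rightarrow> (nat \<Rightarrow> real)) \<Rightarrow> ((nat \<Rightarrow> real) \<Rightarrow> real) \<Rightarrow> ((nat \<Rightarrow> real) \<Rightarrow> real)" where
  "pullback n \<xi> C = (\<lambda>x\<in>Icube n. measure (copula_measure n C) (\<xi> ` lower_box n x))"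

definition concordance_le ::
  "nat \<Rightarrow> ((nat \<Rightarrow> real) \<Rightarrow> real) \<Rightarrow> ((nat \<Rightarrow> real) \<Rightarrow> real) \<Rightarrow> bool" where
  "concordance_le n A B \<longleftrightarrow>
     (\<forall>x\<in>Icube n. A x \<le> B x) \<and>
     (\<forall>x\<in>Icube n. pullback n (reflection {1..n}) A x \<le> pullback n (reflection {1..n}) B x)"

(* The point (1, x_1, ..., x_n) of [0,1]^(n+1). *)

definition cons_one :: "nat \<Rightarrow> (nat \<Rightarrow> real) \<Rightarrow> (nat \<Rightarrow> real)" where
  "cons_one n x = (\<lambda>i\<in>{1..Suc n}. if i = 1 then 1 else x (i - 1))"

(* The values of \<kappa> and r at indices below 2, and of \<kappa> n away from n-copulas, are unconstrained. *)

definition measure_of_concordance ::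
  "(nat \<Rightarrow> ((nat \<Rightarrow> real) \<Rightarrow> real) \<Rightarrow> real) \<Rightarrow> (nat \<Rightarrow> real) \<Rightarrow> bool" where
  "measure_of_concordance \<kappa> r \<longleftrightarrow> (\<forall>n\<ge>2.
     \<kappa> n (copula_M n) = 1 \<and> \<kappa> n (copula_Pi n) = 0 \<and>
     (\<forall>A B. copula n A \<longrightarrow> copula n B \<longrightarrow> concordance_le n A B \<longrightarrow> \<kappa> n A \<le> \<kappa> n B) \<and>
     (\<forall>Cs C. (\<forall>m::nat. copula n (Cs m)) \<longrightarrow> copula n C \<longrightarrow>
        uniform_limit (Icube n) Cs C sequentially \<longrightarrow> (\<lambda>m. \<kappa> n (Cs m)) \<longlonglongrightarrow> \<kappa> n C) \<and>
     (\<forall>C p. copula n C \<longrightarrow> p permutes {1..n} \<longrightarrow>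
        \<kappa> n (pullback n (permutation_map p) C) = \<kappa> n C) \<and>
     (\<forall>C. copula n C \<longrightarrow> \<kappa> n (pullback n (reflection {1..n}) C) = \<kappa> n C) \<and>
     (\<forall>C. copula n C \<longrightarrow> (\<Sum>\<rho>\<in>reflections n. \<kappa> n (pullback n \<rho> C)) = 0) \<and>
     (\<forall>C E. copula n C \<longrightarrow> copula (Suc n) E \<longrightarrow> (\<forall>x\<in>Icube n. C x = E (cons_one n x)) \<longrightarrow>
        r n * \<kappa> n C =
          \<kappa> (Suc n) E + \<kappa> (Suc n) (pullback (Suc n) (elementary_reflection 1) E)))"

lemma reflection_apply:
  assumes "finite S"
  shows "reflection S x = (\<lambda>i. if i \<in> S then 1 - x i else x i)"
proof -
  interpret comp_fun_commute elementary_reflection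
    by unfold_locales (auto simp: elementary_reflection_def fun_eq_iff)
  show ?thesis
    using assms unfolding reflection_def
  proof (induction S)
    case (insert i S)
    then have "Finite_Set.fold elementary_reflection x (insert i S) =
        elementary_reflection i (\<lambda>i. if i \<in> S then 1 - x i else x i)"
      by simp
    also have "\<dots> = (\<lambda>j. if j \<in> insert i S then 1 - x j else x j)"
      using insert(2) by (auto simp: elementary_reflection_def fun_eq_iff)
    finally show ?case .
  qed simp
qed

lemma reflection_singleton: "reflection {i} = elementary_reflection i"
  by (auto simp: fun_eq_iff reflection_apply elementary_reflection_def)

lemma inj_on_reflection: "inj_on reflection (Pow {1..n})"
proof (rule inj_onI)
  fix S T assume *: "S \<in> Pow {1..n}" "T \<in> Pow {1..n}" "reflection S = reflection T"
  hence "finite S" "finite T" by (auto intro: finite_subset)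
  with fun_cong[OF *(3), of "\<lambda>_. 0"] show "S = T"
    by (auto simp: reflection_apply fun_eq_iff split: if_splits)
qed

lemma sets_unit_interval:
  "sets (restrict_space borel {0..1::real}) = sets (sigma {0..1} ((\<lambda>t. {0..t}) ` {0..1::real}))"
proof -
  have b: "sets (borel::real measure) = sigma_sets UNIV (range atMost)"
    by (subst borel_eq_atMost) simp
  have "sets (restrict_space borel {0..1::real}) = sigma_sets {0..1} ((\<inter>) {0..1} ` range atMost)"
    unfolding sets_restrict_space b
    by (rule sigma_sets_Int) (auto simp: b[symmetric])
  also have "\<dots> = sigma_sets {0..1} ((\<lambda>t. {0..t}) ` {0..1::real})"
  proof (rule sigma_sets_eqI)
    fix X assume "X \<in> (\<inter>) {0..1::real} ` range atMost"
    then obtain a where X: "X = {0..1} \<inter> {..a}" by blast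
    show "X \<in> sigma_sets {0..1} ((\<lambda>t. {0..t}) ` {0..1})"
    proof (cases "a < 0")
      case True
      hence "X = {}" unfolding X by auto
      thus ?thesis by (simp add: sigma_sets.Empty)
    next
      case False
      hence "X = {0..min a 1}" "min a 1 \<in> {0..1}" unfolding X by auto
      thus ?thesis by blast
    qed
  next
    fix X assume "X \<in> (\<lambda>t. {0..t}) ` {0..1::real}"
    then obtain t where "t \<in> {0..1}" "X = {0..t}" by auto
    hence "X = {0..1} \<inter> {..t}" by auto
    thus "X \<in> sigma_sets {0..1} ((\<inter>) {0..1::real} ` range atMost)" by blast
  qed
  also have "\<dots> = sets (sigma {0..1} ((\<lambda>t. {0..t}) ` {0..1::real}))"
    by (subst sets_measure_of) auto
  finally show ?thesis .
qed

lemma lower_box_eq: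
  assumes "x \<in> Icube n"
  shows "lower_box n x = {f \<in> Icube n. \<forall>i\<in>{1..n}. f i \<in> {0..x i}}"
proof (intro set_eqI iffI)
  fix f assume f: "f \<in> lower_box n x"
  have "f i \<in> {0..1}" if "i \<in> {1..n}" for i
    using f assms that order_trans[of "f i" "x i" 1] by (auto simp: lower_box_def Icube_def PiE_iff)
  with f show "f \<in> {f \<in> Icube n. \<forall>i\<in>{1..n}. f i \<in> {0..x i}}"
    by (auto simp: lower_box_def Icube_def PiE_iff)
qed (auto simp: lower_box_def Icube_def PiE_iff)

lemma sets_cube:
  "sets (\<Pi>\<^sub>M i\<in>{1..n}. restrict_space borel {0..1::real}) = sigma_sets (Icube n) (lower_box n ` Icube n)"
proof -
  let ?E = "(\<lambda>t. {0..t}) ` {0..1::real}"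
  let ?P = "{{f \<in> {1..n} \<rightarrow>\<^sub>E {0..1}. \<forall>i\<in>j. f i \<in> A i} | A j. j \<in> {{1..n}} \<and> A \<in> j \<rightarrow> ?E}"
  have "sets (\<Pi>\<^sub>M i\<in>{1..n}. restrict_space borel {0..1::real}) = sets (\<Pi>\<^sub>M i\<in>{1..n}. sigma {0..1} ?E)"
    by (intro sets_PiM_cong refl sets_unit_interval)
  also have "\<dots> = sets (sigma ({1..n} \<rightarrow>\<^sub>E {0..1}) ?P)"
  proof (rule sets_PiM_sigma)
    fix i
    show "\<exists>S\<subseteq>?E. countable S \<and> {0..1::real} = \<Union> S"
      by (intro exI[of _ "{{0..1}}"]) auto
  qed auto
  also have "?P = lower_box n ` Icube n"
  proof (intro equalityI subsetI)
    fix X assume "X \<in> ?P"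
    then obtain A where A: "A \<in> {1..n} \<rightarrow> ?E" "X = {f \<in> {1..n} \<rightarrow>\<^sub>E {0..1}. \<forall>i\<in>{1..n}. f i \<in> A i}"
      by auto
    then have "\<forall>i\<in>{1..n}. \<exists>t\<in>{0..1}. A i = {0..t}" by (auto simp: Pi_iff image_iff)
    then obtain t where t: "\<And>i. i \<in> {1..n} \<Longrightarrow> t i \<in> {0..1} \<and> A i = {0..t i}" by metis
    have t': "restrict t {1..n} \<in> Icube n" using t by (simp add: Icube_def PiE_iff)
    moreover have "X = lower_box n (restrict t {1..n})"
      unfolding A(2) lower_box_eq[OF t'] Icube_def[symmetric] using t by auto
    ultimately show "X \<in> lower_box n ` Icube n" by blast
  next
    fix X assume "X \<in> lower_box n ` Icube n"
    then obtain x where x: "x \<in> Icube n" "X = lower_box n x" by auto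
    have "X = {f \<in> {1..n} \<rightarrow>\<^sub>E {0..1}. \<forall>i\<in>{1..n}. f i \<in> {0..x i}}"
      using x lower_box_eq by (simp add: Icube_def)
    moreover have "(\<lambda>i. {0..x i}) \<in> {1..n} \<rightarrow> ?E" using x by (auto simp: Icube_def PiE_iff)
    ultimately show "X \<in> ?P"
      by (intro CollectI exI[of _ "\<lambda>i. {0..x i}"] exI[of _ "{1..n}"]) simp
  qed
  also have "sets (sigma ({1..n} \<rightarrow>\<^sub>E {0..1}) (lower_box n ` Icube n)) = sigma_sets (Icube n) (lower_box n ` Icube n)"
    unfolding Icube_def[symmetric]
    by (subst sets_measure_of) (auto simp: lower_box_eq)
  finally show ?thesis .
qed

lemma represents_copula_unique:
  assumes "represents_copula n \<mu> C" "represents_copula n \<nu> C"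
  shows "\<mu> = \<nu>"
proof -
  interpret M: prob_space \<mu> using assms by (simp add: represents_copula_def)
  interpret N: prob_space \<nu> using assms by (simp add: represents_copula_def)
  have one: "lower_box n (\<lambda>i\<in>{1..n}. 1) = Icube n" "(\<lambda>i\<in>{1..n}. 1) \<in> Icube n"
    by (auto simp: lower_box_def Icube_def PiE_iff)
  show ?thesis
  proof (rule measure_eqI_generator_eq[where \<Omega> = "Icube n" and E = "lower_box n ` Icube n"
        and A = "\<lambda>_. Icube n"])
    show "Int_stable (lower_box n ` Icube n)"
    proof (rule Int_stableI)
      fix a b assume "a \<in> lower_box n ` Icube n" "b \<in> lower_box n ` Icube n"
      then obtain x y where xy: "x \<in> Icube n" "y \<in> Icube n" "a = lower_box n x" "b = lower_box n y" by auto
      define z where "z = (\<lambda>i\<in>{1..n}. min (x i) (y i))"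
      have "a \<inter> b = lower_box n z" unfolding xy by (auto simp: lower_box_def z_def PiE_iff)
      moreover have "z \<in> Icube n" using xy by (auto simp: z_def Icube_def PiE_iff min_def)
      ultimately show "a \<inter> b \<in> lower_box n ` Icube n" by blast
    qed
    show "lower_box n ` Icube n \<subseteq> Pow (Icube n)" by (auto simp: lower_box_eq)
    show "emeasure \<mu> X = emeasure \<nu> X" if "X \<in> lower_box n ` Icube n" for X
      using that assms by (auto simp: represents_copula_def M.emeasure_eq_measure N.emeasure_eq_measure)
    show "sets \<mu> = sigma_sets (Icube n) (lower_box n ` Icube n)"
      using assms by (simp only: represents_copula_def sets_cube)
    show "sets \<nu> = sigma_sets (Icube n) (lower_box n ` Icube n)"
      using assms by (simp only: represents_copula_def sets_cube)
    show "range (\<lambda>_. Icube n) \<subseteq> lower_box n ` Icube n" using one by (metis image_eqI image_subsetI)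
  qed auto
qed

lemma copula_measure_eqI: "represents_copula n \<mu> C \<Longrightarrow> copula_measure n C = \<mu>"
  unfolding copula_measure_def using represents_copula_unique by blast

end

theory Submission
  imports Defs
begin

text \<open>
  Let \<open>a n k\<close> be the value of \<open>\<kappa> n\<close> on \<open>M\<close> reflected in \<open>k\<close> of its \<open>n\<close> coordinates; by A4 the choice
  of these coordinates is irrelevant. The copula \<open>M\<close> reflected in a set of coordinates is the law of
  \<open>(u\<^sub>1, \<dots>, u\<^sub>n)\<close> with each \<open>u\<^sub>i\<close> equal to \<open>t\<close> or \<open>1 - t\<close>, for \<open>t\<close> uniform on the unit interval, so
  dropping its first coordinate gives a copula of the same kind. Hence A7 becomes the recurrence
  \<open>r n * a n k = a (n + 1) k + a (n + 1) (k + 1)\<close>, and \<open>a n 0 = 1\<close> by A1. Letting \<open>n\<close> tend to infinity,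
  induction on \<open>k\<close> gives the limit \<open>r * (r - 1) ^ k - (r - 1) ^ k = (r - 1) ^ (k + 1)\<close>.
\<close>

section \<open>Lebesgue measure on the unit interval\<close>

abbreviation unit_borel :: "real measure" where
  "unit_borel \<equiv> restrict_space borel {0..1}"

abbreviation unit_lborel :: "real measure" where
  "unit_lborel \<equiv> restrict_space lborel {0..1}"

abbreviation cube_borel :: "nat \<Rightarrow> (nat \<Rightarrow> real) measure" where
  "cube_borel n \<equiv> (\<Pi>\<^sub>M i\<in>{1..n}. unit_borel)"

lemma prob_space_unit_lborel: "prob_space unit_lborel"
  by (rule prob_spaceI) (simp add: space_restrict_space emeasure_restrict_space)

lemma sets_unit_lborel [measurable_cong]: "sets unit_lborel = sets unit_borel"
  by (simp add: sets_restrict_space)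

lemma space_cube_borel: "space (cube_borel n) = Icube n"
  by (simp add: space_PiM space_restrict_space Icube_def)

lemma measurable_one_minus [measurable]: "(\<lambda>t. 1 - t) \<in> unit_borel \<rightarrow>\<^sub>M unit_borel"
  by (intro measurable_restrict_space3) auto

text \<open>An affine map of slope -1 preserves Lebesgue measure on the line, and this one maps the
  unit interval onto itself, so it also preserves the restricted measure.\<close>

lemma distr_unit_lborel_one_minus: "distr unit_lborel unit_borel (\<lambda>t. 1 - t) = unit_lborel"
proof (rule measure_eqI)
  fix A assume "A \<in> sets (distr unit_lborel unit_borel (\<lambda>t. 1 - t))"
  then have A: "A \<in> sets borel" "A \<subseteq> {0..1}" and A': "A \<in> sets unit_borel"
    by (auto simp: sets_restrict_space)
  have "lborel = distr lborel borel (\<lambda>t. 1 - t :: real)"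
    using lborel_real_affine[of "-1" 1] by (simp add: density_1)
  then have "emeasure lborel A = emeasure (distr lborel borel (\<lambda>t. 1 - t)) A"
    by simp
  also have "\<dots> = emeasure lborel ((\<lambda>t. 1 - t) -` A)"
    using A by (subst emeasure_distr) auto
  also have "(\<lambda>t. 1 - t) -` A = (\<lambda>t. 1 - t) -` A \<inter> {0..1}"
    using A by auto
  finally show "emeasure (distr unit_lborel unit_borel (\<lambda>t. 1 - t)) A = emeasure unit_lborel A"
    using A A' by (subst emeasure_distr) (auto simp: emeasure_restrict_space space_restrict_space)
qed (simp add: sets_unit_lborel)

subsection \<open>Reflections of the copula M\<close>

text \<open>Parametrises the diagonal of the cube that starts, at \<open>t = 0\<close>, in the
  vertex with coordinates 1 on \<open>S\<close> and 0 elsewhere. The restriction to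
  \<open>{1..n}\<close> makes its points extensional, as \<open>Icube\<close> demands.\<close>

definition reflected_diag :: "nat \<Rightarrow> nat set \<Rightarrow> real \<Rightarrow> nat \<Rightarrow> real" where
  "reflected_diag n S t = (\<lambda>i\<in>{1..n}. if i \<in> S then 1 - t else t)"

definition reflected_diag_measure :: "nat \<Rightarrow> nat set \<Rightarrow> (nat \<Rightarrow> real) measure" where
  "reflected_diag_measure n S = distr unit_lborel (cube_borel n) (reflected_diag n S)"

text \<open>Defined from an explicit law rather than as a pullback of \<open>copula_M\<close>, so
  that the representing measure is known from the start; the agreement with the pullback is derived
  later.\<close>

definition reflected_M :: "nat \<Rightarrow> nat set \<Rightarrow> (nat \<Rightarrow> real) \<Rightarrow> real" where
  "reflected_M n S = (\<lambda>x\<in>Icube n. measure (reflected_diag_measure n S) (lower_box n x))"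

lemma measurable_reflected_diag [measurable]:
  "reflected_diag n S \<in> unit_borel \<rightarrow>\<^sub>M cube_borel n"
  unfolding reflected_diag_def
proof (rule measurable_restrict)
  show "(\<lambda>t. if i \<in> S then 1 - t else t) \<in> unit_borel \<rightarrow>\<^sub>M unit_borel" for i
    by (cases "i \<in> S") simp_all
qed

lemma measurable_reflected_diag' [measurable]:
  "reflected_diag n S \<in> unit_lborel \<rightarrow>\<^sub>M cube_borel n"
  using measurable_reflected_diag measurable_cong_sets[OF sets_unit_lborel refl] by blast

lemma reflected_diag_in_Icube: "t \<in> {0..1} \<Longrightarrow> reflected_diag n S t \<in> Icube n"
  by (auto simp: reflected_diag_def Icube_def)

lemma sets_lower_box: "x \<in> Icube n \<Longrightarrow> lower_box n x \<in> sets (cube_borel n)"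
  unfolding sets_cube by blast

lemma reflected_M_apply:
  assumes "x \<in> Icube n"
  shows "reflected_M n S x =
    measure unit_lborel {t \<in> {0..1}. \<forall>i\<in>{1..n}. (if i \<in> S then 1 - t else t) \<le> x i}"
proof -
  have "reflected_M n S x = measure unit_lborel (reflected_diag n S -` lower_box n x \<inter> {0..1})"
    using assms
    by (simp add: reflected_M_def reflected_diag_measure_def measure_distr sets_lower_box
        space_restrict_space measurable_reflected_diag' del: One_nat_def)
  also have "reflected_diag n S -` lower_box n x \<inter> {0..1} =
      {t \<in> {0..1}. \<forall>i\<in>{1..n}. (if i \<in> S then 1 - t else t) \<le> x i}"
    by (auto simp: reflected_diag_def lower_box_def PiE_iff split: if_split_asm)
  finally show ?thesis .
qed

text \<open>Every coordinate of the random point is \<open>t\<close> or \<open>1 - t\<close>, and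
  both are uniform when \<open>t\<close> is; the values on boxes are right by definition.\<close>

lemma represents_copula_reflected_M:
  "represents_copula n (reflected_diag_measure n S) (reflected_M n S)"
proof -
  have "distr (reflected_diag_measure n S) unit_borel (\<lambda>x. x i) = unit_lborel" if i: "i \<in> {1..n}" for i
  proof -
    have "distr (reflected_diag_measure n S) unit_borel (\<lambda>x. x i) =
        distr unit_lborel unit_borel (\<lambda>t. if i \<in> S then 1 - t else t)"
      unfolding reflected_diag_measure_def using i
      by (subst distr_distr) (auto simp: o_def reflected_diag_def simp del: One_nat_def)
    also have "\<dots> = unit_lborel"
      using distr_unit_lborel_one_minus
      by (cases "i \<in> S") (simp_all add: distr_id2 sets_unit_lborel)
    finally show ?thesis .
  qed
  then show ?thesis
    using prob_space.prob_space_distr[OF prob_space_unit_lborel measurable_reflected_diag']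
    by (simp add: represents_copula_def reflected_M_def reflected_diag_measure_def)
qed

lemma copula_reflected_M:
  assumes "1 \<le> n"
  shows "copula n (reflected_M n S)"
proof -
  interpret prob_space "reflected_diag_measure n S"
    using represents_copula_reflected_M by (simp add: represents_copula_def)
  show ?thesis
    using assms represents_copula_reflected_M by (auto simp: copula_def reflected_M_def)
qed

text \<open>The main diagonal meets the box below \<open>x\<close> exactly for \<open>t\<close>
  between 0 and the least \<open>x i\<close>, an interval whose length is that minimum.\<close>

lemma reflected_M_empty:
  assumes "1 \<le> n"
  shows "reflected_M n {} = copula_M n"
proof (rule ext)
  fix x
  show "reflected_M n {} x = copula_M n x"
  proof (cases "x \<in> Icube n")
    case True
    let ?m = "Min (x ` {1..n})"
    have m: "?m \<in> x ` {1..n}"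
      using assms by (intro Min_in) auto
    with True have m01: "?m \<in> {0..1}"
      by (auto simp: Icube_def PiE_iff)
    have "{t \<in> {0..1}. \<forall>i\<in>{1..n}. t \<le> x i} = {t \<in> {0..1}. t \<le> ?m}"
      using assms by (subst Min_ge_iff) auto
    also have "\<dots> = {0..?m}"
      using m01 by auto
    finally show ?thesis
      using True m01
      by (simp add: reflected_M_apply copula_M_def measure_restrict_space)
  qed (simp add: reflected_M_def copula_M_def)
qed

section \<open>Action of the symmetries of the cube\<close>

text \<open>Images of boxes under \<open>\<xi>\<close> are preimages under its inverse
  \<open>\<xi>'\<close>, so the pullback has as its measure the push-forward along
  \<open>\<xi>'\<close>. It therefore suffices to know where \<open>\<xi>'\<close> sends the
  diagonal, parameter by parameter.\<close>

lemma pullback_reflected_M: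
  assumes meas [measurable]: "\<xi>' \<in> cube_borel n \<rightarrow>\<^sub>M cube_borel n"
    and \<xi>: "\<And>x. x \<in> Icube n \<Longrightarrow> \<xi> x \<in> Icube n"
    and inv: "\<And>x. x \<in> Icube n \<Longrightarrow> \<xi> (\<xi>' x) = x" "\<And>x. x \<in> Icube n \<Longrightarrow> \<xi>' (\<xi> x) = x"
    and diag: "\<And>t. t \<in> {0..1} \<Longrightarrow> \<xi>' (reflected_diag n S t) = reflected_diag n T t"
  shows "pullback n \<xi> (reflected_M n S) = reflected_M n T"
proof (rule ext)
  fix x
  show "pullback n \<xi> (reflected_M n S) x = reflected_M n T x"
  proof (cases "x \<in> Icube n")
    case True
    have sub: "lower_box n x \<subseteq> Icube n"
      using True by (auto simp: lower_box_eq)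
    have "\<xi> ` lower_box n x = \<xi>' -` lower_box n x \<inter> Icube n"
    proof (intro equalityI subsetI)
      fix y assume "y \<in> \<xi> ` lower_box n x"
      then show "y \<in> \<xi>' -` lower_box n x \<inter> Icube n"
        using sub \<xi> inv(2) by auto
    next
      fix y assume "y \<in> \<xi>' -` lower_box n x \<inter> Icube n"
      then have "y = \<xi> (\<xi>' y)" "\<xi>' y \<in> lower_box n x"
        using inv(1) by auto
      then show "y \<in> \<xi> ` lower_box n x"
        by (rule image_eqI)
    qed
    \<comment> \<open>Uniqueness of the representing measure identifies
      \<open>copula_measure\<close> with the explicit law.\<close>
    then have "pullback n \<xi> (reflected_M n S) x =
        measure (distr (reflected_diag_measure n S) (cube_borel n) \<xi>') (lower_box n x)"
      using True copula_measure_eqI[OF represents_copula_reflected_M, of n S]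
      by (subst measure_distr) (simp_all add: pullback_def reflected_diag_measure_def sets_lower_box space_cube_borel
          del: One_nat_def)
    also have "distr (reflected_diag_measure n S) (cube_borel n) \<xi>' = reflected_diag_measure n T"
      unfolding reflected_diag_measure_def
      by (subst distr_distr) (auto intro!: distr_cong simp: space_restrict_space diag simp del: One_nat_def)
    finally show ?thesis
      using True by (simp add: reflected_M_def[of n T])
  qed (simp add: pullback_def reflected_M_def)
qed

text \<open>A reflection is its own inverse. Reflecting a coordinate twice would restore it, so in
  general the symmetric difference appears; disjointness turns it into the union.\<close>

lemma pullback_reflection_reflected_M:
  assumes "T \<subseteq> {1..n}" "S \<inter> T = {}"
  shows "pullback n (reflection T) (reflected_M n S) = reflected_M n (S \<union> T)"
proof (rule pullback_reflected_M[where \<xi>' = "reflection T"])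
  have fin: "finite T"
    using assms(1) by (rule finite_subset) simp
  have cube: "reflection T x \<in> Icube n" if "x \<in> Icube n" for x
    using that assms(1) by (auto simp: Icube_def PiE_iff reflection_apply[OF fin] extensional_def)
  show "reflection T \<in> cube_borel n \<rightarrow>\<^sub>M cube_borel n"
  proof (rule measurable_PiM_single')
    fix i assume i: "i \<in> {1..n}"
    then have "(\<lambda>x. x i) \<in> cube_borel n \<rightarrow>\<^sub>M unit_borel"
      by (rule measurable_component_singleton)
    then show "(\<lambda>x. reflection T x i) \<in> cube_borel n \<rightarrow>\<^sub>M unit_borel"
      by (cases "i \<in> T") (simp_all add: reflection_apply[OF fin]
          measurable_compose[OF _ measurable_one_minus])
  next
    have "reflection T \<in> Icube n \<rightarrow> Icube n"
      using cube by blast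
    then show "reflection T \<in> space (cube_borel n) \<rightarrow> {1..n} \<rightarrow>\<^sub>E space unit_borel"
      unfolding space_cube_borel by (simp add: space_restrict_space Icube_def)
  qed
  show "reflection T x \<in> Icube n" if "x \<in> Icube n" for x
    using that by (rule cube)
  show "reflection T (reflection T x) = x" for x
    by (auto simp: reflection_apply[OF fin])
  show "reflection T (reflection T x) = x" for x
    by (auto simp: reflection_apply[OF fin])
  show "reflection T (reflected_diag n S t) = reflected_diag n (S \<union> T) t" for t
    using assms by (auto simp: reflection_apply[OF fin] reflected_diag_def fun_eq_iff)
qed

text \<open>The inverse permutation acts on the diagonal: its coordinate \<open>i\<close> becomes
  the old coordinate \<open>inv p i\<close>, which is reflected iff \<open>i\<close> lies in the
  image of \<open>S\<close> under \<open>p\<close>.\<close>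

lemma pullback_permutation_reflected_M:
  assumes p: "p permutes {1..n}"
  shows "pullback n (permutation_map p) (reflected_M n S) = reflected_M n (p ` S)"
proof (rule pullback_reflected_M[where \<xi>' = "permutation_map (inv p)"])
  have cube: "permutation_map q x \<in> Icube n" if "x \<in> Icube n" "q permutes {1..n}" for q x
    using that permutes_in_image[OF that(2)]
    by (auto simp: Icube_def PiE_iff permutation_map_def extensional_def)
  have p': "inv p permutes {1..n}"
    using p by (rule permutes_inv)
  show "permutation_map (inv p) \<in> cube_borel n \<rightarrow>\<^sub>M cube_borel n"
  proof (rule measurable_PiM_single')
    fix i assume "i \<in> {1..n}"
    then have "inv p i \<in> {1..n}"
      using permutes_in_image[OF p'] by blast
    then show "(\<lambda>x. permutation_map (inv p) x i) \<in> cube_borel n \<rightarrow>\<^sub>M unit_borel"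
      unfolding permutation_map_def by (rule measurable_component_singleton)
  next
    have "permutation_map (inv p) \<in> Icube n \<rightarrow> Icube n"
      using cube[OF _ p'] by blast
    then show "permutation_map (inv p) \<in> space (cube_borel n) \<rightarrow> {1..n} \<rightarrow>\<^sub>E space unit_borel"
      unfolding space_cube_borel by (simp add: space_restrict_space Icube_def)
  qed
  show "permutation_map p x \<in> Icube n" if "x \<in> Icube n" for x
    using that p by (rule cube)
  show "permutation_map p (permutation_map (inv p) x) = x" for x
    by (simp add: permutation_map_def permutes_inverses[OF p])
  show "permutation_map (inv p) (permutation_map p x) = x" for x
    by (simp add: permutation_map_def permutes_inverses[OF p])
  show "permutation_map (inv p) (reflected_diag n S t) = reflected_diag n (p ` S) t" for t
  proof
    fix i
    have "inv p i \<in> S \<longleftrightarrow> i \<in> p ` S"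
      using permutes_inverses[OF p] by (metis image_iff)
    then show "permutation_map (inv p) (reflected_diag n S t) i = reflected_diag n (p ` S) t i"
      using permutes_in_image[OF p', of i] by (simp add: permutation_map_def reflected_diag_def)
  qed
qed

section \<open>Deleting the first coordinate\<close>

lemma cons_one_in_Icube:
  assumes "x \<in> Icube n"
  shows "cons_one n x \<in> Icube (Suc n)"
proof -
  have "x (i - 1) \<in> {0..1}" if "i \<in> {1..Suc n}" "i \<noteq> 1" for i
  proof -
    have "i - 1 \<in> {1..n}"
      using that by auto
    with assms show ?thesis
      unfolding Icube_def by (rule PiE_mem)
  qed
  then show ?thesis
    by (auto simp: cons_one_def Icube_def simp del: One_nat_def)
qed

text \<open>The bound 1 on the first coordinate is met by both \<open>t\<close> and
  \<open>1 - t\<close>, so only the other coordinates constrain \<open>t\<close>; their indices, and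
  with them \<open>S\<close>, are shifted by one.\<close>

lemma reflected_M_cons_one:
  assumes "x \<in> Icube n"
  shows "reflected_M (Suc n) (Suc ` S) (cons_one n x) = reflected_M n S x"
proof -
  have split: "{1..Suc n} = insert 1 (Suc ` {1..n})"
    by (auto simp: image_Suc_atLeastAtMost)
  have "(\<forall>i\<in>{1..Suc n}. (if i \<in> Suc ` S then 1 - t else t) \<le> cons_one n x i) \<longleftrightarrow>
      (\<forall>i\<in>{1..n}. (if i \<in> S then 1 - t else t) \<le> x i)" if "t \<in> {0..1}" for t
    unfolding split using that
    by (simp add: cons_one_def inj_image_mem_iff del: image_Suc_atLeastAtMost)
  then have "{t \<in> {0..1}. \<forall>i\<in>{1..Suc n}. (if i \<in> Suc ` S then 1 - t else t) \<le> cons_one n x i} =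
      {t \<in> {0..1}. \<forall>i\<in>{1..n}. (if i \<in> S then 1 - t else t) \<le> x i}"
    by blast
  then show ?thesis
    unfolding reflected_M_apply[OF assms] reflected_M_apply[OF cons_one_in_Icube[OF assms]]
    by (rule arg_cong)
qed

section \<open>Permutations carrying one subset onto another\<close>

text \<open>The complements in \<open>A\<close> also have equal cardinality, so a bijection of the
  sets and one of the complements can be glued, with the identity outside \<open>A\<close>.\<close>

lemma exists_permutation_image:
  assumes "finite A" "S \<subseteq> A" "T \<subseteq> A" "card S = card T"
  shows "\<exists>p. p permutes A \<and> p ` S = T"
proof -
  have fin: "finite S" "finite T"
    using assms by (auto intro: finite_subset)
  obtain f where f: "bij_betw f S T"
    using finite_same_card_bij[OF fin assms(4)] by blast
  have "card (A - S) = card (A - T)"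
    using assms fin by (simp add: card_Diff_subset)
  then obtain g where g: "bij_betw g (A - S) (A - T)"
    using finite_same_card_bij[of "A - S" "A - T"] assms(1) by blast
  define p where "p x = (if x \<in> S then f x else if x \<in> A then g x else x)" for x
  have pS: "bij_betw p S T"
    using f by (rule bij_betw_cong[THEN iffD1, rotated]) (simp add: p_def)
  have "bij_betw p (A - S) (A - T)"
    using g by (rule bij_betw_cong[THEN iffD1, rotated]) (simp add: p_def)
  with pS have "bij_betw p (S \<union> (A - S)) (T \<union> (A - T))"
    by (rule bij_betw_combine) auto
  moreover have "S \<union> (A - S) = A" "T \<union> (A - T) = A"
    using assms by auto
  ultimately have "p permutes A"
    using assms(2) by (intro bij_imp_permutes) (auto simp: p_def)
  with pS show ?thesis
    by (auto simp: bij_betw_def)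
qed

subsection \<open>The recurrence\<close>

text \<open>A4 applied to a permutation carrying \<open>S\<close> onto \<open>T\<close>; this allows
  \<open>{1..k}\<close> to stand for every set of \<open>k\<close> coordinates.\<close>

lemma concordance_reflected_M_card:
  assumes \<kappa>: "measure_of_concordance \<kappa> r" and n: "n \<ge> 2"
    and S: "S \<subseteq> {1..n}" "T \<subseteq> {1..n}" "card S = card T"
  shows "\<kappa> n (reflected_M n S) = \<kappa> n (reflected_M n T)"
proof -
  obtain p where p: "p permutes {1..n}" "p ` S = T"
    using exists_permutation_image[of "{1..n}" S T] S by auto
  have "\<kappa> n (pullback n (permutation_map p) (reflected_M n S)) = \<kappa> n (reflected_M n S)"
    using \<kappa> n p(1) copula_reflected_M[of n S] unfolding measure_of_concordance_def by auto
  then show ?thesis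
    using p by (simp add: pullback_permutation_reflected_M)
qed

lemma concordance_reflected_M_recurrence:
  assumes \<kappa>: "measure_of_concordance \<kappa> r" and n: "n \<ge> 2" and k: "k \<le> n"
  shows "r n * \<kappa> n (reflected_M n {1..k}) =
    \<kappa> (Suc n) (reflected_M (Suc n) {1..k}) + \<kappa> (Suc n) (reflected_M (Suc n) {1..Suc k})"
proof -
  \<comment> \<open>Coordinate 1 is left unreflected in \<open>?E\<close>: deleting it leaves the
    copula with reflected set \<open>{1..k}\<close>, while reflecting it, as in A7, enlarges the
    reflected set by one element.\<close>
  let ?E = "reflected_M (Suc n) (Suc ` {1..k})"
  have "r n * \<kappa> n (reflected_M n {1..k}) =
      \<kappa> (Suc n) ?E + \<kappa> (Suc n) (pullback (Suc n) (elementary_reflection 1) ?E)"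
    using \<kappa> n copula_reflected_M[of n "{1..k}"] copula_reflected_M[of "Suc n" "Suc ` {1..k}"]
      reflected_M_cons_one[of _ n "{1..k}"]
    unfolding measure_of_concordance_def by auto
  also have "pullback (Suc n) (elementary_reflection 1) ?E = reflected_M (Suc n) (Suc ` {1..k} \<union> {1})"
    unfolding reflection_singleton[symmetric] by (rule pullback_reflection_reflected_M) auto
  also have "Suc ` {1..k} \<union> {1} = {1..Suc k}"
    by (auto simp: image_Suc_atLeastAtMost)
  \<comment> \<open>The shifted set \<open>{2..Suc k}\<close> has the same cardinality as
    \<open>{1..k}\<close>, and both lie in \<open>{1..Suc n}\<close> because
    \<open>k \<le> n\<close>.\<close>
  also have "\<kappa> (Suc n) ?E = \<kappa> (Suc n) (reflected_M (Suc n) {1..k})"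
    by (rule concordance_reflected_M_card[OF \<kappa>]) (use n k in \<open>auto simp: card_image\<close>)
  finally show ?thesis .
qed

lemma concordance_reflected_M_tendsto:
  assumes \<kappa>: "measure_of_concordance \<kappa> r" and r: "r \<longlonglongrightarrow> r\<^sub>0"
  shows "(\<lambda>n. \<kappa> n (reflected_M n {1..k})) \<longlonglongrightarrow> (r\<^sub>0 - 1) ^ k"
proof (induction k)
  case 0
  have "\<kappa> n (reflected_M n {1..0}) = 1" if "n \<ge> 2" for n
    using \<kappa> that reflected_M_empty[of n] by (simp add: measure_of_concordance_def)
  then show ?case
    by (auto intro!: tendsto_eventually eventually_sequentiallyI[of 2])
next
  case (Suc k)
  \<comment> \<open>The recurrence is solved for its term with \<open>Suc k\<close> reflections; the
    subtracted term has the limit of the induction hypothesis, since shifting the index does not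
    affect limits.\<close>
  have "(\<lambda>n. r n * \<kappa> n (reflected_M n {1..k}) - \<kappa> (Suc n) (reflected_M (Suc n) {1..k}))
      \<longlonglongrightarrow> r\<^sub>0 * (r\<^sub>0 - 1) ^ k - (r\<^sub>0 - 1) ^ k"
    using Suc.IH r by (intro tendsto_intros LIMSEQ_Suc)
  moreover have "\<forall>\<^sub>F n in sequentially.
      r n * \<kappa> n (reflected_M n {1..k}) - \<kappa> (Suc n) (reflected_M (Suc n) {1..k}) =
      \<kappa> (Suc n) (reflected_M (Suc n) {1..Suc k})"
    using concordance_reflected_M_recurrence[OF \<kappa>, of _ k]
    by (intro eventually_sequentiallyI[of "max k 2"]) simp
  ultimately have "(\<lambda>n. \<kappa> (Suc n) (reflected_M (Suc n) {1..Suc k}))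
      \<longlonglongrightarrow> r\<^sub>0 * (r\<^sub>0 - 1) ^ k - (r\<^sub>0 - 1) ^ k"
    by (rule Lim_transform_eventually)
  \<comment> \<open>A7 yields the value in dimension \<open>Suc n\<close>, so the index shift has to
    be undone.\<close>
  then have "(\<lambda>n. \<kappa> n (reflected_M n {1..Suc k})) \<longlonglongrightarrow> r\<^sub>0 * (r\<^sub>0 - 1) ^ k - (r\<^sub>0 - 1) ^ k"
    by (rule LIMSEQ_imp_Suc)
  then show ?case
    by (simp add: algebra_simps)
qed

theorem corollary2:
  fixes \<kappa> :: "nat \<Rightarrow> ((nat \<Rightarrow> real) \<Rightarrow> real) \<Rightarrow> real"
    and r :: "nat \<Rightarrow> real" and r\<^sub>0 :: real
    and s :: nat and S :: "nat \<Rightarrow> nat set"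
  assumes "measure_of_concordance \<kappa> r"
    and "r \<longlonglongrightarrow> r\<^sub>0"
    and "s > 0"
    and "\<And>n. n \<ge> max s 2 \<Longrightarrow> S n \<subseteq> {1..n} \<and> card (S n) = s"
  shows "(\<lambda>n. \<kappa> n (pullback n (reflection (S n)) (copula_M n))) \<longlonglongrightarrow> (-1) ^ s * (1 - r\<^sub>0) ^ s"
proof -
  have "\<kappa> n (reflected_M n {1..s}) = \<kappa> n (pullback n (reflection (S n)) (copula_M n))"
    if n: "n \<ge> max s 2" for n
  proof -
    have S: "S n \<subseteq> {1..n}" "card (S n) = s"
      using assms(4)[OF n] by auto
    \<comment> \<open>\<open>copula_M n\<close> is the case of the empty reflected set, which is
      disjoint from \<open>S n\<close>.\<close>
    have "pullback n (reflection (S n)) (copula_M n) = reflected_M n (S n)"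
      using n S pullback_reflection_reflected_M[of "S n" n "{}"] by (simp add: reflected_M_empty)
    moreover have "\<kappa> n (reflected_M n {1..s}) = \<kappa> n (reflected_M n (S n))"
      by (rule concordance_reflected_M_card[OF assms(1)]) (use n S in auto)
    ultimately show ?thesis
      by simp
  qed
  \<comment> \<open>The identification holds from \<open>max s 2\<close> on, where
    \<open>S n\<close> is constrained and the axioms apply; eventual equality is enough for the
    limit.\<close>
  then have "(\<lambda>n. \<kappa> n (pullback n (reflection (S n)) (copula_M n))) \<longlonglongrightarrow> (r\<^sub>0 - 1) ^ s"
    by (intro Lim_transform_eventually[OF concordance_reflected_M_tendsto[OF assms(1,2)]]
        eventually_sequentiallyI[of "max s 2"])
  also have "(r\<^sub>0 - 1) ^ s = (-1) ^ s * (1 - r\<^sub>0) ^ s"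
    by (simp flip: power_mult_distrib)
  finally show ?thesis .
qed

end
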